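(* For every formula $A$ of the language of classical propositional logic (i.e., built from $\bot$ and atomic propositions by $\to$, without any subformula of the form $t:B$), $\vdash_{\mathsf{SE}} A$ if and only if $\vdash_{\mathsf{CL}} A$.
   Context: Syntax of $\mathsf{SE}$. There are countably infinite sets of justification constants $\mathsf{JConst}=\{0,1,c_1,c_2,\dots\}$ and justification variables $\mathsf{JVar}$. Terms: constants, variables, and $s\cdot t$, $s+t$ for terms $s,t$. Formulas: $\bot$, atomic propositions $P\in\mathsf{Prop}$, $A\to B$, and $t:A$; $\neg,\wedge,\vee,\leftrightarrow$ are abbreviations. $A[w/t]$ is simultaneous replacement of the variable $w$ by term $t$. Axioms of $\mathsf{SE}$ (for arbitrary formulas $A,B$ and variables $w,x,y,z$): (CL) propositional tautologies; (j) $x:(A\to B)\to(y:A\to x\cdot y:B)$; (j+) $x:A\wedge y:A\to(x+y):A$; (a+) $A[w/(x+y)+z]\to A[w/x+(y+z)]$; (c+) $A[w/x+y]\to A[w/y+x]$; (0+) $A[w/x+0]\leftrightarrow A[w/x]$; (am) $A[w/(x\cdot y)\cdot z]\leftrightarrow A[w/x\cdot(y\cdot z)]$; (a0) $A[w/x\cdot 0]\leftrightarrow A[w/0]$, $A[w/0\cdot x]\leftrightarrow A[w/0]$; (a1) $A[w/x\cdot 1]\leftrightarrow A[w/x]$, $A[w/1\cdot x]\leftrightarrow A[w/x]$; (dl) $A[w/x\cdot(y+z)]\leftrightarrow A[w/x\cdot y+x\cdot z]$; (dr) $A[w/(y+z)\cdot x]\leftrightarrow A[w/y\cdot x+z\cdot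 x]$. Rules: modus ponens and (jv): from $A$ infer $A[x/t]$. $\vdash_{\mathsf{SE}}F$ means $F$ is derivable from the axioms by these rules. $\vdash_{\mathsf{CL}}$ denotes derivability in classical propositional logic. *)

theory Defs
  imports Main
begin

text \<open>\<open>C i\<close> stands for the constant \<open>c\<close> with index \<open>i + 1\<close>.\<close>

datatype jconst = Zero | One | C nat

datatype jterm =
    Const jconst
  | Var nat
  | App jterm jterm (infixl "\<cdot>" 70)
  | Sum jterm jterm (infixl "\<oplus>" 65)

abbreviation jzero :: jterm ("\<zero>") where "\<zero> \<equiv> Const Zero"
abbreviation jone :: jterm ("\<one>") where "\<one> \<equiv> Const One"

text \<open>The type parameter \<open>'p\<close> is the set of atomic propositions.\<close>

datatype 'p fm =
    Falsum
  | Atom 'p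
  | Imp "'p fm" "'p fm" (infixr "\<^bold>\<rightarrow>" 25)
  | Just jterm "'p fm" (infixr "\<^bold>:" 55)

abbreviation Neg :: "'p fm \<Rightarrow> 'p fm" ("\<^bold>\<not> _" [40] 40) where
  "\<^bold>\<not> A \<equiv> (A \<^bold>\<rightarrow> Falsum)"

abbreviation Conj :: "'p fm \<Rightarrow> 'p fm \<Rightarrow> 'p fm" (infixr "\<^bold>\<and>" 35) where
  "A \<^bold>\<and> B \<equiv> \<^bold>\<not> (A \<^bold>\<rightarrow> \<^bold>\<not> B)"

abbreviation (input) Disj :: "'p fm \<Rightarrow> 'p fm \<Rightarrow> 'p fm" (infixr "\<^bold>\<or>" 30) where
  "A \<^bold>\<or> B \<equiv> (\<^bold>\<not> A \<^bold>\<rightarrow> B)"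

abbreviation Iff :: "'p fm \<Rightarrow> 'p fm \<Rightarrow> 'p fm" (infix "\<^bold>\<leftrightarrow>" 25) where
  "A \<^bold>\<leftrightarrow> B \<equiv> (A \<^bold>\<rightarrow> B) \<^bold>\<and> (B \<^bold>\<rightarrow> A)"

primrec tsubst :: "jterm \<Rightarrow> nat \<Rightarrow> jterm \<Rightarrow> jterm" where
  "tsubst (Const c) w t = Const c"
| "tsubst (Var x) w t = (if x = w then t else Var x)"
| "tsubst (r \<cdot> s) w t = tsubst r w t \<cdot> tsubst s w t"
| "tsubst (r \<oplus> s) w t = tsubst r w t \<oplus> tsubst s w t"

primrec fsubst :: "'p fm \<Rightarrow> nat \<Rightarrow> jterm \<Rightarrow> 'p fm" ("_\<langle>_'/_\<rangle>" [1000, 0, 0] 1000) where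
  "fsubst Falsum w t = Falsum"
| "fsubst (Atom P) w t = Atom P"
| "fsubst (A \<^bold>\<rightarrow> B) w t = (fsubst A w t \<^bold>\<rightarrow> fsubst B w t)"
| "fsubst (s \<^bold>: A) w t = (tsubst s w t \<^bold>: fsubst A w t)"

text \<open>
  Tautologies of the full language: a valuation assigns arbitrary truth values to
  the propositionally indecomposable formulas, i.e. to atoms and to formulas \<open>t \<^bold>: A\<close>.
\<close>

primrec eval :: "('p fm \<Rightarrow> bool) \<Rightarrow> 'p fm \<Rightarrow> bool" where
  "eval v Falsum \<longleftrightarrow> False"
| "eval v (Atom P) \<longleftrightarrow> v (Atom P)"
| "eval v (A \<^bold>\<rightarrow> B) \<longleftrightarrow> (eval v A \<longrightarrow> eval v B)"
| "eval v (t \<^bold>: A) \<longleftrightarrow> v (t \<^bold>: A)"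

definition tautology :: "'p fm \<Rightarrow> bool" where
  "tautology A \<longleftrightarrow> (\<forall>v. eval v A)"

inductive se_axiom :: "'p fm \<Rightarrow> bool" where
  CL: "tautology A \<Longrightarrow> se_axiom A"
| j: "se_axiom (Var x \<^bold>: (A \<^bold>\<rightarrow> B) \<^bold>\<rightarrow> (Var y \<^bold>: A \<^bold>\<rightarrow> (Var x \<cdot> Var y) \<^bold>: B))"
| j_plus: "se_axiom ((Var x \<^bold>: A \<^bold>\<and> Var y \<^bold>: A) \<^bold>\<rightarrow> (Var x \<oplus> Var y) \<^bold>: A)"
| a_plus: "se_axiom (A\<langle>w/(Var x \<oplus> Var y) \<oplus> Var z\<rangle> \<^bold>\<rightarrow> A\<langle>w/Var x \<oplus> (Var y \<oplus> Var z)\<rangle>)"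
| c_plus: "se_axiom (A\<langle>w/Var x \<oplus> Var y\<rangle> \<^bold>\<rightarrow> A\<langle>w/Var y \<oplus> Var x\<rangle>)"
| zero_plus: "se_axiom (A\<langle>w/Var x \<oplus> \<zero>\<rangle> \<^bold>\<leftrightarrow> A\<langle>w/Var x\<rangle>)"
| am: "se_axiom (A\<langle>w/(Var x \<cdot> Var y) \<cdot> Var z\<rangle> \<^bold>\<leftrightarrow> A\<langle>w/Var x \<cdot> (Var y \<cdot> Var z)\<rangle>)"
| a0_right: "se_axiom (A\<langle>w/Var x \<cdot> \<zero>\<rangle> \<^bold>\<leftrightarrow> A\<langle>w/\<zero>\<rangle>)"
| a0_left: "se_axiom (A\<langle>w/\<zero> \<cdot> Var x\<rangle> \<^bold>\<leftrightarrow> A\<langle>w/\<zero>\<rangle>)"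
| a1_right: "se_axiom (A\<langle>w/Var x \<cdot> \<one>\<rangle> \<^bold>\<leftrightarrow> A\<langle>w/Var x\<rangle>)"
| a1_left: "se_axiom (A\<langle>w/\<one> \<cdot> Var x\<rangle> \<^bold>\<leftrightarrow> A\<langle>w/Var x\<rangle>)"
| dl: "se_axiom (A\<langle>w/Var x \<cdot> (Var y \<oplus> Var z)\<rangle> \<^bold>\<leftrightarrow> A\<langle>w/Var x \<cdot> Var y \<oplus> Var x \<cdot> Var z\<rangle>)"
| dr: "se_axiom (A\<langle>w/(Var y \<oplus> Var z) \<cdot> Var x\<rangle> \<^bold>\<leftrightarrow> A\<langle>w/Var y \<cdot> Var x \<oplus> Var z \<cdot> Var x\<rangle>)"

inductive se_derivable :: "'p fm \<Rightarrow> bool" ("\<turnstile>\<^sub>S\<^sub>E _" [20] 20) where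
  ax: "se_axiom A \<Longrightarrow> \<turnstile>\<^sub>S\<^sub>E A"
| mp: "(\<turnstile>\<^sub>S\<^sub>E A \<^bold>\<rightarrow> B) \<Longrightarrow> (\<turnstile>\<^sub>S\<^sub>E A) \<Longrightarrow> \<turnstile>\<^sub>S\<^sub>E B"
| jv: "(\<turnstile>\<^sub>S\<^sub>E A) \<Longrightarrow> \<turnstile>\<^sub>S\<^sub>E A\<langle>x/t\<rangle>"

primrec classical :: "'p fm \<Rightarrow> bool" where
  "classical Falsum \<longleftrightarrow> True"
| "classical (Atom P) \<longleftrightarrow> True"
| "classical (A \<^bold>\<rightarrow> B) \<longleftrightarrow> classical A \<and> classical B"
| "classical (t \<^bold>: A) \<longleftrightarrow> False"

text \<open>
  A standard Hilbert calculus for classical propositional logic in \<open>\<bottom>, \<rightarrow>\<close>; every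
  formula occurring in a derivation belongs to the classical language.
\<close>

inductive cl_derivable :: "'p fm \<Rightarrow> bool" ("\<turnstile>\<^sub>C\<^sub>L _" [20] 20) where
  K: "classical A \<Longrightarrow> classical B \<Longrightarrow> \<turnstile>\<^sub>C\<^sub>L A \<^bold>\<rightarrow> (B \<^bold>\<rightarrow> A)"
| S: "classical A \<Longrightarrow> classical B \<Longrightarrow> classical D \<Longrightarrow>
      \<turnstile>\<^sub>C\<^sub>L (A \<^bold>\<rightarrow> (B \<^bold>\<rightarrow> D)) \<^bold>\<rightarrow> ((A \<^bold>\<rightarrow> B) \<^bold>\<rightarrow> (A \<^bold>\<rightarrow> D))"
| DN: "classical A \<Longrightarrow> \<turnstile>\<^sub>C\<^sub>L \<^bold>\<not> \<^bold>\<not> A \<^bold>\<rightarrow> A"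
| MP: "(\<turnstile>\<^sub>C\<^sub>L A \<^bold>\<rightarrow> B) \<Longrightarrow> (\<turnstile>\<^sub>C\<^sub>L A) \<Longrightarrow> \<turnstile>\<^sub>C\<^sub>L B"

end

theory Submission imports Defs begin

text \<open>
  Reading every formula \<open>t \<^bold>: A\<close> as true validates all axioms and rules of \<open>SE\<close>, since this
  reading does not see terms. Hence a classical theorem of \<open>SE\<close> is a tautology, and is derivable
  in \<open>CL\<close> by Kalmar's completeness argument: a formula or its negation follows from the
  literals describing a valuation, and the literals are then discharged one atom at a time.
\<close>

definition just_true :: "('p \<Rightarrow> bool) \<Rightarrow> 'p fm \<Rightarrow> bool" where
  "just_true v F = (case F of Atom P \<Rightarrow> v P | _ \<Rightarrow> True)"

lemma just_true_simps [simp]: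
  "just_true v (Atom P) = v P"
  "just_true v (t \<^bold>: A) = True"
  by (simp_all add: just_true_def)

lemma eval_just_true_fsubst [simp]:
  "eval (just_true v) (A\<langle>w/t\<rangle>) = eval (just_true v) A"
  by (induction A) auto

lemma se_axiom_sound: "se_axiom A \<Longrightarrow> eval (just_true v) A"
  by (induction rule: se_axiom.induct) (auto simp: tautology_def)

lemma se_sound: "(\<turnstile>\<^sub>S\<^sub>E A) \<Longrightarrow> eval (just_true v) A"
  by (induction rule: se_derivable.induct) (auto simp: se_axiom_sound)

text \<open>The axioms of the Hilbert calculus are tautologies, hence covered by \<open>CL\<close>,
  and modus ponens is common to both systems.\<close>

lemma cl_imp_se: "(\<turnstile>\<^sub>C\<^sub>L A) \<Longrightarrow> \<turnstile>\<^sub>S\<^sub>E A"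
proof (induction rule: cl_derivable.induct)
  case (MP A B)
  then show ?case by (blast intro: mp)
qed (auto intro!: ax CL simp: tautology_def)

text \<open>The Hilbert calculus has no premises, but Kalmar's argument reasons from literals. The
  side condition in \<open>Assm\<close> keeps every entailed formula classical for arbitrary
  \<open>G\<close>.\<close>

inductive cl_entails :: "'p fm set \<Rightarrow> 'p fm \<Rightarrow> bool" (infix "\<tturnstile>" 20) for G where
  Assm: "A \<in> G \<Longrightarrow> classical A \<Longrightarrow> G \<tturnstile> A"
| Thm: "(\<turnstile>\<^sub>C\<^sub>L A) \<Longrightarrow> G \<tturnstile> A"
| MP: "G \<tturnstile> (A \<^bold>\<rightarrow> B) \<Longrightarrow> G \<tturnstile> A \<Longrightarrow> G \<tturnstile> B"

lemma cl_derivable_classical: "(\<turnstile>\<^sub>C\<^sub>L A) \<Longrightarrow> classical A"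
  by (induction rule: cl_derivable.induct) auto

lemma cl_entails_classical: "G \<tturnstile> A \<Longrightarrow> classical A"
  by (induction rule: cl_entails.induct) (auto simp: cl_derivable_classical)

lemma cl_entails_empty: "{} \<tturnstile> A \<Longrightarrow> \<turnstile>\<^sub>C\<^sub>L A"
  by (induction rule: cl_entails.induct) (auto intro: cl_derivable.MP)

lemma cl_entails_mono: "G \<tturnstile> A \<Longrightarrow> G \<subseteq> H \<Longrightarrow> H \<tturnstile> A"
  by (induction rule: cl_entails.induct) (auto intro: cl_entails.intros)

lemma cl_entails_weaken: "G \<tturnstile> A \<Longrightarrow> insert B G \<tturnstile> A"
  by (rule cl_entails_mono) auto

lemma cl_entails_imp_const: "G \<tturnstile> B \<Longrightarrow> classical A \<Longrightarrow> G \<tturnstile> (A \<^bold>\<rightarrow> B)"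
  by (meson cl_derivable.K cl_entails.MP Thm cl_entails_classical)

lemma cl_imp_refl: "classical A \<Longrightarrow> \<turnstile>\<^sub>C\<^sub>L A \<^bold>\<rightarrow> A"
  by (meson classical.simps(3) cl_derivable.intros)

lemma deduction_theorem:
  assumes "insert A G \<tturnstile> B" "classical A"
  shows "G \<tturnstile> (A \<^bold>\<rightarrow> B)"
  using assms
proof (induction rule: cl_entails.induct)
  case (Assm B)
  then show ?case
    by (metis Thm cl_entails.Assm cl_entails_imp_const cl_imp_refl insertE)
next
  case (Thm B)
  then show ?case by (simp add: cl_entails.Thm cl_entails_imp_const)
next
  case (MP B D)
  then have "classical B" "classical D"
    using cl_entails_classical by fastforce+
  with MP show ?case
    by (meson cl_derivable.S cl_entails.MP Thm)
qed

lemma cl_entails_by_contradiction: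
  assumes "insert (\<^bold>\<not> A) G \<tturnstile> Falsum" "classical A"
  shows "G \<tturnstile> A"
  using deduction_theorem[OF assms(1)] assms(2) cl_derivable.DN cl_entails.MP Thm
  by (metis classical.simps(1,3))

lemma cl_entails_cases:
  assumes pos: "insert P G \<tturnstile> A" and neg: "insert (\<^bold>\<not> P) G \<tturnstile> A" and P: "classical P"
  shows "G \<tturnstile> A"
proof (rule cl_entails_by_contradiction)
  show A: "classical A" using pos by (rule cl_entails_classical)
  have nA: "insert (\<^bold>\<not> A) G \<tturnstile> (\<^bold>\<not> A)" using A by (auto intro: Assm)
  have "insert P (insert (\<^bold>\<not> A) G) \<tturnstile> A" using pos by (rule cl_entails_mono) auto
  then have "insert (\<^bold>\<not> A) G \<tturnstile> (\<^bold>\<not> P)"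
    using nA P by (blast intro: deduction_theorem cl_entails_weaken cl_entails.MP)
  moreover have "insert (\<^bold>\<not> A) G \<tturnstile> (\<^bold>\<not> P \<^bold>\<rightarrow> A)"
    using deduction_theorem[OF neg] P by (auto intro: cl_entails_weaken)
  ultimately show "insert (\<^bold>\<not> A) G \<tturnstile> Falsum"
    using nA by (blast intro: cl_entails.MP)
qed

definition literal :: "('p \<Rightarrow> bool) \<Rightarrow> 'p \<Rightarrow> 'p fm" where
  "literal v P = (if v P then Atom P else \<^bold>\<not> (Atom P))"

text \<open>Asking only for an inclusion in \<open>G\<close> lets the same \<open>G\<close> serve
  both subformulas of an implication in the induction.\<close>

lemma kalmar:
  assumes "classical A" "literal v ` set_fm A \<subseteq> G"
  shows "G \<tturnstile> (if eval (just_true v) A then A else \<^bold>\<not> A)"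
  using assms
proof (induction A)
  case Falsum
  then show ?case by (simp add: Thm cl_imp_refl)
next
  case (Atom P)
  then show ?case by (auto simp: literal_def intro: Assm split: if_splits)
next
  case (Imp A B)
  then have cl: "classical A" "classical B"
    and IHA: "G \<tturnstile> (if eval (just_true v) A then A else \<^bold>\<not> A)"
    and IHB: "G \<tturnstile> (if eval (just_true v) B then B else \<^bold>\<not> B)"
    by (auto simp: image_Un)
  consider "eval (just_true v) B" | "\<not> eval (just_true v) A"
    | "eval (just_true v) A" "\<not> eval (just_true v) B" by blast
  then show ?case
  proof cases
    case 1
    then show ?thesis using IHB cl by (simp add: cl_entails_imp_const)
  next
    case 2
    let ?H = "insert (\<^bold>\<not> B) (insert A G)"
    have "?H \<tturnstile> (\<^bold>\<not> A)" using 2 IHA by (auto intro: cl_entails_weaken)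
    moreover have "?H \<tturnstile> A" using cl by (auto intro: Assm)
    ultimately have "insert A G \<tturnstile> B"
      using cl by (blast intro: cl_entails_by_contradiction cl_entails.MP)
    then show ?thesis using 2 cl by (simp add: deduction_theorem)
  next
    case 3
    let ?H = "insert (A \<^bold>\<rightarrow> B) G"
    have "?H \<tturnstile> (A \<^bold>\<rightarrow> B)" using cl by (auto intro: Assm)
    moreover have "?H \<tturnstile> A" "?H \<tturnstile> (\<^bold>\<not> B)"
      using 3 IHA IHB by (auto intro: cl_entails_weaken)
    ultimately have "?H \<tturnstile> Falsum" by (blast intro: cl_entails.MP)
    then show ?thesis using 3 cl by (simp add: deduction_theorem)
  qed
qed simp

lemma discharge_literals:
  assumes "finite S" "\<And>v. literal v ` S \<tturnstile> A"
  shows "{} \<tturnstile> A"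
  using assms
proof (induction S rule: finite_induct)
  case (insert P S)
  have "literal v ` S \<tturnstile> A" for v
  proof (rule cl_entails_cases)
    \<comment> \<open>As \<open>P\<close> lies outside \<open>S\<close>, changing \<open>v\<close>
      at \<open>P\<close> affects no other literal. The two updates of \<open>v\<close> therefore
      supply the two branches of the case distinction on \<open>P\<close>.\<close>
    have "literal (v(P := b)) ` S = literal v ` S" for b
      using insert.hyps by (auto simp: literal_def intro!: image_cong)
    then show "insert (Atom P) (literal v ` S) \<tturnstile> A" "insert (\<^bold>\<not> (Atom P)) (literal v ` S) \<tturnstile> A"
      using insert.prems[of "v(P := True)"] insert.prems[of "v(P := False)"]
      by (simp_all add: literal_def)
  qed simp
  then show ?case by (rule insert.IH)
qed simp

lemma finite_atoms: "finite (set_fm A)"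
  by (induction A) auto

lemma cl_complete:
  assumes "classical A" "\<And>v. eval (just_true v) A"
  shows "\<turnstile>\<^sub>C\<^sub>L A"
proof (rule cl_entails_empty, rule discharge_literals[OF finite_atoms])
  show "literal v ` set_fm A \<tturnstile> A" for v
    \<comment> \<open>Truth under every valuation selects the positive alternative, \<open>A\<close>
      itself, for each \<open>v\<close>.\<close>
    using kalmar[OF assms(1) subset_refl] assms(2) by metis
qed

theorem mainTheorem5:
  fixes A :: "'p fm"
  assumes "classical A"
  shows "(\<turnstile>\<^sub>S\<^sub>E A) \<longleftrightarrow> (\<turnstile>\<^sub>C\<^sub>L A)"
  using assms cl_complete se_sound cl_imp_se by blast

end
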